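(* Assume that $f'$ exists and is continuous in a neighborhood of $-\theta$, and that $h_n=cn^{-d}$ with $c>0$ and $\frac14<d<\frac12$. If the kernel $k$ is symmetric around the origin, then $$\frac{\widetilde W-E_\theta(\widetilde W)}{\sqrt{V_\theta(\widetilde W)}}\ \to\ N(0,1)\quad\text{in law as } n\to\infty.$$
   Context: $X_1,X_2,\dots,X_n$ are i.i.d. real random variables with distribution function $F(x-\theta)$, where $\theta\in\mathbb R$ is a fixed location parameter and $F$ has a density $f$ satisfying $f(-x)=f(x)$ for all $x$. $E_\theta$ and $V_\theta$ denote expectation and variance under this model. The kernel $k:\mathbb R\to\mathbb R$ satisfies $\int_{-\infty}^{\infty}k(u)\,du=1$ (it may take negative values), and is called symmetric (around the origin) if $k(-u)=k(u)$. Put $K(t)=\int_{-\infty}^t k(u)\,du$. The bandwidth $h_n>0$ satisfies $h_n\to0$ as $n\to\infty$. The smoothed Wilcoxon signed rank statistic is $$\widetilde W=\frac{n(n+1)}2-\sum_{1\le i\le j\le n}K\Bigl(-\frac{X_i+X_j}{2h_n}\Bigr).$$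
   Formalization: The formal theorem additionally assumes 0 < F(−θ) < 1 (observations are positive and negative each with positive probability); without it the statistic can be constant for large n, with variance zero. *)

theory Defs
  imports "HOL-Probability.Probability"
begin

text \<open>The set integral is a Lebesgue integral, so it is the intended antiderivative
  for Lebesgue-integrable kernels only; the kernel may take negative values.\<close>

definition kernel_cdf :: "(real \<Rightarrow> real) \<Rightarrow> real \<Rightarrow> real" where
  "kernel_cdf k t = (LBINT u:{..t}. k u)"

text \<open>The observations \<open>x 1, \<dots>, x n\<close> are indexed from 1; the value \<open>x 0\<close> is not used.
  The double sum runs over all pairs with \<open>1 \<le> i \<le> j \<le> n\<close>, the diagonal included.\<close>

definition smoothed_wilcoxon :: "(real \<Rightarrow> real) \<Rightarrow> real \<Rightarrow> nat \<Rightarrow> (nat \<Rightarrow> real) \<Rightarrow> real" where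
  "smoothed_wilcoxon k h n x =
     real n * (real n + 1) / 2
     - (\<Sum>j=1..n. \<Sum>i=1..j. kernel_cdf k (- ((x i + x j) / (2 * h))))"

text \<open>The density need not be differentiable outside the neighbourhood.\<close>

definition deriv_continuous_near :: "(real \<Rightarrow> real) \<Rightarrow> real \<Rightarrow> bool" where
  "deriv_continuous_near f a \<longleftrightarrow>
     (\<exists>e>0. (\<forall>x\<in>ball a e. f differentiable (at x)) \<and> continuous_on (ball a e) (deriv f))"

end

theory Submission
  imports Defs
begin

text \<open>The constant \<open>n * (n + 1) / 2\<close> counts the pairs \<open>i \<le> j\<close>, so \<open>W n\<close> is the sum over
  these pairs of \<open>\<phi> n (X i) (X j)\<close> with \<open>\<phi> n x y = 1 - K (- (x + y) / (2 * h n))\<close>: a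
  U-statistic, with its diagonal terms, whose bounded symmetric kernel depends on \<open>n\<close>. As
  the bandwidth tends to 0 and \<open>k\<close> has integral 1, \<open>\<phi> n x y\<close> tends for \<open>x + y \<noteq> 0\<close> to the
  indicator of \<open>x + y > 0\<close>, the kernel of the unsmoothed Wilcoxon statistic.

  Let \<open>g x\<close> be the probability that \<open>x + X 1 > 0\<close>, which is the limit of \<open>E (\<phi> n x (X 1))\<close>
  by dominated convergence. The idea is Hoeffding's decomposition: the centered statistic is
  \<open>n\<close> times the sum of the independent variables \<open>g (X i) - E (g (X i))\<close>, plus a remainder
  with second moment \<open>o(n^3)\<close>. The remainder has two parts. One is a sum of completely
  degenerate pair terms; these are pairwise orthogonal, so its second moment is only
  \<open>O(n^2)\<close> (\<open>expectation_square_degenerate_pair_sum_le\<close>). The other is a sum of \<open>n\<close>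
  independent terms, whose size is governed by the mean square distance between \<open>g\<close> and the
  projection of \<open>\<phi> n\<close>, which vanishes in the limit. The classical central limit theorem
  applies to the main part, which has variance of order \<open>n^3\<close> as soon as \<open>g (X 1)\<close> is not
  almost surely constant.

  A perturbation that is small in mean square changes neither the limit law nor the limit of
  the second moments, so the main part may be replaced by the whole statistic and its
  standard deviation by that of the whole statistic (\<open>weak_conv_m_L2_close_normalized\<close>).
  This yields \<open>triangular_U_statistic_asymptotically_normal\<close>, of which the theorem is an
  instance.

  For the non-degeneracy, symmetry of \<open>f\<close> gives \<open>g x = G (x + 2 * \<theta>)\<close> for the distribution
  function \<open>G\<close> of the observations. If \<open>g (X 1)\<close> were almost surely a constant \<open>a\<close>, then \<open>0
  < F (- \<theta>) < 1\<close>, which says that positive and negative observations both have positive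
  probability, would force \<open>0 < a < 1\<close>; but a continuous \<open>G\<close>, shifted or not, cannot almost
  surely take one value strictly between 0 and 1 (\<open>cdf_shift_not_AE_constant\<close>).\<close>

section \<open>Stability of weak limits under small perturbations\<close>

lemma norm_iexp_diff_le: "cmod (iexp a - iexp b) \<le> \<bar>a - b\<bar>"
proof -
  have "iexp a - iexp b = iexp b * (iexp (a - b) - 1)"
    by (simp add: algebra_simps flip: exp_add)
  then have "cmod (iexp a - iexp b) = cmod (iexp (a - b) - 1)"
    by (simp add: norm_mult)
  also have "\<dots> \<le> \<bar>a - b\<bar>"
    using iexp_approx1[of "a - b" 0] by simp
  finally show ?thesis .
qed

text \<open>Characteristic functions are Lipschitz with respect to the \<open>L\<^sup>1\<close> distance of the
  random variables, so Levy's continuity theorem transfers the limit.\<close>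

lemma (in prob_space) weak_conv_m_L1_close:
  fixes S T :: "nat \<Rightarrow> 'a \<Rightarrow> real"
  assumes [measurable]: "\<And>n. random_variable borel (S n)" "\<And>n. random_variable borel (T n)"
    and int: "\<And>n. integrable M (\<lambda>\<omega>. T n \<omega> - S n \<omega>)"
    and close: "(\<lambda>n. expectation (\<lambda>\<omega>. \<bar>T n \<omega> - S n \<omega>\<bar>)) \<longlonglongrightarrow> 0"
    and N: "real_distribution N"
    and conv: "weak_conv_m (\<lambda>n. distr M borel (S n)) N"
  shows "weak_conv_m (\<lambda>n. distr M borel (T n)) N"
proof (rule levy_continuity)
  fix t :: real
  have conv_S: "(\<lambda>n. char (distr M borel (S n)) t) \<longlonglongrightarrow> char N t"
    by (intro levy_continuity1 N conv real_distribution_distr) simp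
  have bound: "cmod (char (distr M borel (T n)) t - char (distr M borel (S n)) t)
      \<le> \<bar>t\<bar> * expectation (\<lambda>\<omega>. \<bar>T n \<omega> - S n \<omega>\<bar>)" for n
  proof -
    have ints: "integrable M (\<lambda>\<omega>. iexp (t * T n \<omega>))" "integrable M (\<lambda>\<omega>. iexp (t * S n \<omega>))"
      by (auto intro!: integrable_const_bound[where B = 1])
    have "char (distr M borel (T n)) t - char (distr M borel (S n)) t
        = (CLINT \<omega>|M. iexp (t * T n \<omega>) - iexp (t * S n \<omega>))"
      using ints by (simp add: char_def integral_distr)
    also have "cmod \<dots> \<le> expectation (\<lambda>\<omega>. cmod (iexp (t * T n \<omega>) - iexp (t * S n \<omega>)))"
      by simp
    also have "\<dots> \<le> expectation (\<lambda>\<omega>. \<bar>t\<bar> * \<bar>T n \<omega> - S n \<omega>\<bar>)"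
    proof (rule integral_mono)
      show "cmod (iexp (t * T n \<omega>) - iexp (t * S n \<omega>)) \<le> \<bar>t\<bar> * \<bar>T n \<omega> - S n \<omega>\<bar>" for \<omega>
        using norm_iexp_diff_le[of "t * T n \<omega>" "t * S n \<omega>"]
        by (simp add: abs_mult[symmetric] right_diff_distrib)
    qed (use ints int in auto)
    finally show ?thesis by simp
  qed
  have "(\<lambda>n. char (distr M borel (T n)) t - char (distr M borel (S n)) t) \<longlonglongrightarrow> 0"
  proof (rule Lim_null_comparison)
    show "(\<lambda>n. \<bar>t\<bar> * expectation (\<lambda>\<omega>. \<bar>T n \<omega> - S n \<omega>\<bar>)) \<longlonglongrightarrow> 0"
      using tendsto_mult_right_zero[OF close] by simp
  qed (simp add: bound)
  from tendsto_add[OF this conv_S]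
  show "(\<lambda>n. char (distr M borel (T n)) t) \<longlonglongrightarrow> char N t" by simp
qed (simp_all add: N real_distribution_distr)

lemma (in prob_space) expectation_abs_le_sqrt:
  fixes Z :: "'a \<Rightarrow> real"
  assumes [measurable]: "random_variable borel Z" and "integrable M (\<lambda>\<omega>. (Z \<omega>)\<^sup>2)"
  shows "expectation (\<lambda>\<omega>. \<bar>Z \<omega>\<bar>) \<le> sqrt (expectation (\<lambda>\<omega>. (Z \<omega>)\<^sup>2))"
proof (rule real_le_rsqrt)
  have "integrable M (\<lambda>\<omega>. \<bar>Z \<omega>\<bar>)"
    using square_integrable_imp_integrable[OF assms] by simp
  then show "(expectation (\<lambda>\<omega>. \<bar>Z \<omega>\<bar>))\<^sup>2 \<le> expectation (\<lambda>\<omega>. (Z \<omega>)\<^sup>2)"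
    using variance_eq[of "\<lambda>\<omega>. \<bar>Z \<omega>\<bar>"] variance_positive[of "\<lambda>\<omega>. \<bar>Z \<omega>\<bar>"] assms by simp
qed

text \<open>Closeness in mean square makes the second moments of \<open>U n\<close> and \<open>A n\<close> share their
  limit, so dividing \<open>U n\<close> by the root of its own second moment is asymptotically the same
  as dividing by \<open>\<sigma>\<close>.\<close>

lemma (in prob_space) weak_conv_m_L2_close_normalized:
  fixes A U :: "nat \<Rightarrow> 'a \<Rightarrow> real"
  assumes [measurable]: "\<And>n. random_variable borel (A n)" "\<And>n. random_variable borel (U n)"
    and A2: "\<And>n. integrable M (\<lambda>\<omega>. (A n \<omega>)\<^sup>2)"
    and U2: "\<And>n. integrable M (\<lambda>\<omega>. (U n \<omega>)\<^sup>2)"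
    and \<sigma>: "\<sigma> > 0" "(\<lambda>n. expectation (\<lambda>\<omega>. (A n \<omega>)\<^sup>2)) \<longlonglongrightarrow> \<sigma>\<^sup>2"
    and close: "(\<lambda>n. expectation (\<lambda>\<omega>. (U n \<omega> - A n \<omega>)\<^sup>2)) \<longlonglongrightarrow> 0"
    and N: "real_distribution N"
    and conv: "weak_conv_m (\<lambda>n. distr M borel (\<lambda>\<omega>. A n \<omega> / \<sigma>)) N"
  shows "weak_conv_m
    (\<lambda>n. distr M borel (\<lambda>\<omega>. U n \<omega> / sqrt (expectation (\<lambda>\<omega>. (U n \<omega>)\<^sup>2)))) N"
proof -
  define D where "D n = expectation (\<lambda>\<omega>. (U n \<omega> - A n \<omega>)\<^sup>2)" for n
  define \<tau> where "\<tau> n = sqrt (expectation (\<lambda>\<omega>. (U n \<omega>)\<^sup>2))" for n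
  \<comment> \<open>The weight \<open>s n\<close> balances \<open>2ab \<le> s a\<^sup>2 + b\<^sup>2 / s\<close> below. The summand \<open>1 / Suc n\<close> keeps it positive when \<open>D n = 0\<close>.\<close>
  define s where "s n = sqrt (D n) + 1 / real (Suc n)" for n
  have D: "D \<longlonglongrightarrow> 0" using close by (simp add: D_def[abs_def])
  have D_nonneg: "D n \<ge> 0" for n by (simp add: D_def)
  have sqrtD: "(\<lambda>n. sqrt (D n)) \<longlonglongrightarrow> 0"
    using tendsto_real_sqrt[OF D] by simp
  have s_pos: "s n > 0" for n
    using D_nonneg[of n] by (simp add: s_def add_nonneg_pos)
  have s: "s \<longlonglongrightarrow> 0"
    using tendsto_add[OF sqrtD lim_inverse_n'[THEN LIMSEQ_Suc]] by (simp add: s_def[abs_def])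
  have UA: "integrable M (\<lambda>\<omega>. (U n \<omega> - A n \<omega>)\<^sup>2)" for n
  proof (rule Bochner_Integration.integrable_bound)
    show "integrable M (\<lambda>\<omega>. 2 * (U n \<omega>)\<^sup>2 + 2 * (A n \<omega>)\<^sup>2)" using A2 U2 by auto
    have "(x - y)\<^sup>2 \<le> 2 * x\<^sup>2 + 2 * y\<^sup>2" for x y :: real
      using zero_le_power2[of "x + y"] by (simp add: power2_eq_square algebra_simps)
    then show "AE \<omega> in M. norm ((U n \<omega> - A n \<omega>)\<^sup>2) \<le> norm (2 * (U n \<omega>)\<^sup>2 + 2 * (A n \<omega>)\<^sup>2)"
      by (auto intro!: AE_I2)
  qed simp
  have int1: "integrable M (A n)" "integrable M (U n)" for n
    using A2 U2 by (auto intro: square_integrable_imp_integrable)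
  have second_moment_close:
    "\<bar>expectation (\<lambda>\<omega>. (U n \<omega>)\<^sup>2) - expectation (\<lambda>\<omega>. (A n \<omega>)\<^sup>2)\<bar>
      \<le> D n + s n * expectation (\<lambda>\<omega>. (A n \<omega>)\<^sup>2) + sqrt (D n)" for n
  proof -
    have pw: "\<bar>u\<^sup>2 - a\<^sup>2\<bar> \<le> (u - a)\<^sup>2 + (s n * a\<^sup>2 + (u - a)\<^sup>2 / s n)" for u a :: real
    proof -
      have "0 \<le> (s n * \<bar>a\<bar> - \<bar>u - a\<bar>)\<^sup>2 / s n" using s_pos[of n] by simp
      also have "\<dots> = s n * a\<^sup>2 + (u - a)\<^sup>2 / s n - 2 * \<bar>a\<bar> * \<bar>u - a\<bar>"
        using s_pos[of n] by (simp add: power2_diff power_mult_distrib field_simps power2_eq_square)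
      finally have "2 * \<bar>a\<bar> * \<bar>u - a\<bar> \<le> s n * a\<^sup>2 + (u - a)\<^sup>2 / s n" by simp
      moreover have "u\<^sup>2 - a\<^sup>2 = (u - a)\<^sup>2 + 2 * a * (u - a)"
        by (simp add: power2_eq_square algebra_simps)
      then have "\<bar>u\<^sup>2 - a\<^sup>2\<bar> \<le> (u - a)\<^sup>2 + 2 * \<bar>a\<bar> * \<bar>u - a\<bar>"
        using abs_triangle_ineq[of "(u - a)\<^sup>2" "2 * a * (u - a)"] by (simp add: abs_mult)
      ultimately show ?thesis by linarith
    qed
    have "\<bar>expectation (\<lambda>\<omega>. (U n \<omega>)\<^sup>2) - expectation (\<lambda>\<omega>. (A n \<omega>)\<^sup>2)\<bar>
        = \<bar>expectation (\<lambda>\<omega>. (U n \<omega>)\<^sup>2 - (A n \<omega>)\<^sup>2)\<bar>"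
      using A2 U2 by simp
    also have "\<dots> \<le> expectation (\<lambda>\<omega>. \<bar>(U n \<omega>)\<^sup>2 - (A n \<omega>)\<^sup>2\<bar>)" by (rule integral_abs_bound)
    also have "\<dots> \<le> expectation (\<lambda>\<omega>. (U n \<omega> - A n \<omega>)\<^sup>2
        + (s n * (A n \<omega>)\<^sup>2 + (U n \<omega> - A n \<omega>)\<^sup>2 / s n))"
      using A2 U2 UA by (intro integral_mono pw) auto
    also have "\<dots> = D n + (s n * expectation (\<lambda>\<omega>. (A n \<omega>)\<^sup>2) + D n / s n)"
      using A2 UA by (simp add: D_def)
    also have "D n / s n \<le> sqrt (D n)"
    proof -
      have "D n = sqrt (D n) * sqrt (D n)" using D_nonneg by simp
      also have "\<dots> \<le> sqrt (D n) * s n"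
        using D_nonneg by (intro mult_left_mono) (auto simp: s_def)
      finally show ?thesis using s_pos[of n] by (simp add: field_simps)
    qed
    finally show ?thesis by simp
  qed
  have "(\<lambda>n. expectation (\<lambda>\<omega>. (U n \<omega>)\<^sup>2) - expectation (\<lambda>\<omega>. (A n \<omega>)\<^sup>2)) \<longlonglongrightarrow> 0"
  proof (rule Lim_null_comparison)
    show "(\<lambda>n. D n + s n * expectation (\<lambda>\<omega>. (A n \<omega>)\<^sup>2) + sqrt (D n)) \<longlonglongrightarrow> 0"
      using tendsto_add[OF tendsto_add[OF D tendsto_mult[OF s \<sigma>(2)]] sqrtD] by simp
  qed (simp add: second_moment_close)
  from tendsto_add[OF this \<sigma>(2)] have "(\<lambda>n. expectation (\<lambda>\<omega>. (U n \<omega>)\<^sup>2)) \<longlonglongrightarrow> \<sigma>\<^sup>2" by simp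
  then have \<tau>: "\<tau> \<longlonglongrightarrow> \<sigma>"
    using tendsto_real_sqrt[of _ "\<sigma>\<^sup>2"] \<sigma>(1) by (fastforce simp: \<tau>_def[abs_def])
  have L1_close: "expectation (\<lambda>\<omega>. \<bar>U n \<omega> / \<tau> n - A n \<omega> / \<sigma>\<bar>)
      \<le> sqrt (D n) * \<bar>1 / \<tau> n\<bar> + sqrt (expectation (\<lambda>\<omega>. (A n \<omega>)\<^sup>2)) * \<bar>1 / \<tau> n - 1 / \<sigma>\<bar>" for n
  proof -
    have "\<bar>u / \<tau> n - a / \<sigma>\<bar> \<le> \<bar>u - a\<bar> * \<bar>1 / \<tau> n\<bar> + \<bar>a\<bar> * \<bar>1 / \<tau> n - 1 / \<sigma>\<bar>" for u a :: real
    proof -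
      \<comment> \<open>This identity also holds when \<open>\<tau> n = 0\<close>, by the convention for division by 0.\<close>
      have "u / \<tau> n - a / \<sigma> = (u - a) * (1 / \<tau> n) + a * (1 / \<tau> n - 1 / \<sigma>)"
        by (simp add: left_diff_distrib right_diff_distrib diff_divide_distrib)
      then show ?thesis
        using abs_triangle_ineq[of "(u - a) * (1 / \<tau> n)" "a * (1 / \<tau> n - 1 / \<sigma>)"]
        by (simp only: abs_mult)
    qed
    then have "expectation (\<lambda>\<omega>. \<bar>U n \<omega> / \<tau> n - A n \<omega> / \<sigma>\<bar>)
        \<le> expectation (\<lambda>\<omega>. \<bar>U n \<omega> - A n \<omega>\<bar> * \<bar>1 / \<tau> n\<bar> + \<bar>A n \<omega>\<bar> * \<bar>1 / \<tau> n - 1 / \<sigma>\<bar>)"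
      using int1 by (intro integral_mono) auto
    also have "\<dots> = expectation (\<lambda>\<omega>. \<bar>U n \<omega> - A n \<omega>\<bar>) * \<bar>1 / \<tau> n\<bar>
        + expectation (\<lambda>\<omega>. \<bar>A n \<omega>\<bar>) * \<bar>1 / \<tau> n - 1 / \<sigma>\<bar>"
      using int1 by simp
    also have "\<dots> \<le> sqrt (D n) * \<bar>1 / \<tau> n\<bar>
        + sqrt (expectation (\<lambda>\<omega>. (A n \<omega>)\<^sup>2)) * \<bar>1 / \<tau> n - 1 / \<sigma>\<bar>"
      unfolding D_def using A2 UA
      by (intro add_mono mult_right_mono expectation_abs_le_sqrt) auto
    finally show ?thesis .
  qed
  have "weak_conv_m (\<lambda>n. distr M borel (\<lambda>\<omega>. U n \<omega> / \<tau> n)) N"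
  proof (rule weak_conv_m_L1_close[OF _ _ _ _ N conv])
    have inv: "(\<lambda>n. 1 / \<tau> n) \<longlonglongrightarrow> 1 / \<sigma>"
      using \<tau> \<sigma>(1) by (intro tendsto_intros) auto
    have "(\<lambda>n. sqrt (D n) * \<bar>1 / \<tau> n\<bar>
        + sqrt (expectation (\<lambda>\<omega>. (A n \<omega>)\<^sup>2)) * \<bar>1 / \<tau> n - 1 / \<sigma>\<bar>)
        \<longlonglongrightarrow> 0 * \<bar>1 / \<sigma>\<bar> + sqrt (\<sigma>\<^sup>2) * \<bar>1 / \<sigma> - 1 / \<sigma>\<bar>"
      by (intro tendsto_intros sqrtD inv \<sigma>(2))
    then have *: "(\<lambda>n. sqrt (D n) * \<bar>1 / \<tau> n\<bar>
        + sqrt (expectation (\<lambda>\<omega>. (A n \<omega>)\<^sup>2)) * \<bar>1 / \<tau> n - 1 / \<sigma>\<bar>) \<longlonglongrightarrow> 0" by simp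
    show "(\<lambda>n. expectation (\<lambda>\<omega>. \<bar>U n \<omega> / \<tau> n - A n \<omega> / \<sigma>\<bar>)) \<longlonglongrightarrow> 0"
      by (rule Lim_null_comparison[OF _ *]) (use L1_close in simp)
  qed (use int1 in auto)
  then show ?thesis by (simp add: \<tau>_def)
qed

section \<open>Orthogonality for functions of independent observations\<close>

lemma integral_square_sum_orthogonal:
  fixes Z :: "'i \<Rightarrow> 'a \<Rightarrow> real"
  assumes "finite S"
    and int: "\<And>s t. s \<in> S \<Longrightarrow> t \<in> S \<Longrightarrow> integrable M (\<lambda>\<omega>. Z s \<omega> * Z t \<omega>)"
    and orth: "\<And>s t. s \<in> S \<Longrightarrow> t \<in> S \<Longrightarrow> s \<noteq> t \<Longrightarrow> (\<integral>\<omega>. Z s \<omega> * Z t \<omega> \<partial>M) = 0"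
  shows "(\<integral>\<omega>. (\<Sum>s\<in>S. Z s \<omega>)\<^sup>2 \<partial>M) = (\<Sum>s\<in>S. \<integral>\<omega>. (Z s \<omega>)\<^sup>2 \<partial>M)"
proof -
  have "(\<integral>\<omega>. (\<Sum>s\<in>S. Z s \<omega>)\<^sup>2 \<partial>M) = (\<Sum>s\<in>S. \<Sum>t\<in>S. \<integral>\<omega>. Z s \<omega> * Z t \<omega> \<partial>M)"
    using int by (simp add: power2_eq_square sum_product)
  also have "\<dots> = (\<Sum>s\<in>S. \<Sum>t\<in>S. if t = s then \<integral>\<omega>. (Z s \<omega>)\<^sup>2 \<partial>M else 0)"
    using orth by (intro sum.cong refl) (auto simp: power2_eq_square)
  also have "\<dots> = (\<Sum>s\<in>S. \<integral>\<omega>. (Z s \<omega>)\<^sup>2 \<partial>M)"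
    using \<open>finite S\<close> by simp
  finally show ?thesis .
qed

text \<open>The measure \<open>P\<close> is the common law of the observations and at the same time the
  measurable space in which they take their values.\<close>

locale iid_sequence = prob_space M + P: prob_space P
  for M :: "'a measure" and P :: "'b measure" +
  fixes X :: "nat \<Rightarrow> 'a \<Rightarrow> 'b"
  assumes indep: "indep_vars (\<lambda>_. P) X UNIV"
    and distr_X: "\<And>i. distr M P (X i) = P"
begin

lemma measurable_X [measurable]: "X i \<in> measurable M P"
  using indep by (simp add: indep_vars_def2)

lemma expectation_X:
  fixes r :: "'b \<Rightarrow> real"
  assumes [measurable]: "r \<in> borel_measurable P"
  shows "expectation (\<lambda>\<omega>. r (X i \<omega>)) = (\<integral>x. r x \<partial>P)"
  using integral_distr[of "X i" M P r] by (simp add: distr_X)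

text \<open>The observation \<open>X l\<close> is independent of the three others, so integrating it out first
  gives 0 by degeneracy. Repetitions among \<open>i\<close>, \<open>j\<close>, \<open>k\<close> are allowed; this single fact
  therefore covers overlapping pairs, disjoint pairs and single observations.\<close>

lemma expectation_mult_degenerate:
  fixes u v :: "'b \<Rightarrow> 'b \<Rightarrow> real"
  assumes [measurable]: "(\<lambda>(x, y). u x y) \<in> borel_measurable (P \<Otimes>\<^sub>M P)"
    and [measurable]: "(\<lambda>(x, y). v x y) \<in> borel_measurable (P \<Otimes>\<^sub>M P)"
    and u_le: "\<And>x y. \<bar>u x y\<bar> \<le> B" and v_le: "\<And>x y. \<bar>v x y\<bar> \<le> C"
    and v_0: "\<And>x. x \<in> space P \<Longrightarrow> (\<integral>y. v x y \<partial>P) = 0"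
    and l: "l \<notin> {i, j, k}"
  shows "expectation (\<lambda>\<omega>. u (X i \<omega>) (X j \<omega>) * v (X k \<omega>) (X l \<omega>)) = 0"
proof -
  let ?I = "{i, j, k}"
  let ?Y = "\<lambda>\<omega>. restrict (\<lambda>m. X m \<omega>) ?I" and ?Z = "\<lambda>\<omega>. restrict (\<lambda>m. X m \<omega>) {l}"
  define Q where "Q = distr M (PiM ?I (\<lambda>_. P)) ?Y"
  define R where "R = distr M (PiM {l} (\<lambda>_. P)) ?Z"
  \<comment> \<open>Both members of an independent pair must have the same type, so \<open>X l\<close> is kept as a one-point tuple.\<close>
  have "indep_var (PiM ?I (\<lambda>_. P)) ?Y (PiM {l} (\<lambda>_. P)) ?Z"
    using l by (intro indep_var_restrict[OF indep]) auto
  then have joint: "distr M (PiM ?I (\<lambda>_. P) \<Otimes>\<^sub>M PiM {l} (\<lambda>_. P)) (\<lambda>\<omega>. (?Y \<omega>, ?Z \<omega>)) = Q \<Otimes>\<^sub>M R"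
    unfolding Q_def R_def by (simp add: indep_var_distribution_eq)
  have Y[measurable]: "?Y \<in> measurable M (PiM ?I (\<lambda>_. P))"
    and Z[measurable]: "?Z \<in> measurable M (PiM {l} (\<lambda>_. P))"
    by (intro measurable_restrict; simp)+
  interpret Q: prob_space Q unfolding Q_def by (rule prob_space_distr) (rule Y)
  interpret R: prob_space R unfolding R_def by (rule prob_space_distr) (rule Z)
  interpret QR: pair_prob_space Q R ..
  have sets_Q: "sets Q = sets (PiM ?I (\<lambda>_. P))" and sets_R: "sets R = sets (PiM {l} (\<lambda>_. P))"
    by (simp_all add: Q_def R_def)
  let ?h = "\<lambda>p. u (fst p i) (fst p j) * v (fst p k) (snd p l)"
  have h[measurable]: "?h \<in> borel_measurable (PiM ?I (\<lambda>_. P) \<Otimes>\<^sub>M PiM {l} (\<lambda>_. P))"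
  proof -
    have [measurable]: "(\<lambda>p. fst p m) \<in> measurable (PiM ?I (\<lambda>_. P) \<Otimes>\<^sub>M PiM {l} (\<lambda>_. P)) P"
      if "m \<in> ?I" for m
      using measurable_compose[OF measurable_fst measurable_component_singleton[OF that]] .
    have [measurable]: "(\<lambda>p. snd p l) \<in> measurable (PiM ?I (\<lambda>_. P) \<Otimes>\<^sub>M PiM {l} (\<lambda>_. P)) P"
      using measurable_compose[OF measurable_snd measurable_component_singleton] by simp
    have "(\<lambda>p. u (fst p i) (fst p j)) \<in> borel_measurable (PiM ?I (\<lambda>_. P) \<Otimes>\<^sub>M PiM {l} (\<lambda>_. P))"
      using measurable_compose[of "\<lambda>p. (fst p i, fst p j)" _ "P \<Otimes>\<^sub>M P" "\<lambda>(x, y). u x y" borel] by simp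
    moreover
    have "(\<lambda>p. v (fst p k) (snd p l)) \<in> borel_measurable (PiM ?I (\<lambda>_. P) \<Otimes>\<^sub>M PiM {l} (\<lambda>_. P))"
      using measurable_compose[of "\<lambda>p. (fst p k, snd p l)" _ "P \<Otimes>\<^sub>M P" "\<lambda>(x, y). v x y" borel] by simp
    ultimately show ?thesis by (rule borel_measurable_times)
  qed
  have "?h \<in> borel_measurable (Q \<Otimes>\<^sub>M R)"
    using h unfolding measurable_cong_sets[OF sets_pair_measure_cong[OF sets_Q sets_R] refl] .
  then have int: "integrable (Q \<Otimes>\<^sub>M R) ?h"
  proof (rule QR.P.integrable_const_bound[where B = "B * C", rotated])
    show "AE p in Q \<Otimes>\<^sub>M R. norm (?h p) \<le> B * C"
    proof (intro AE_I2)
      fix p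
      have "0 \<le> B" by (rule order_trans[OF abs_ge_zero u_le])
      then show "norm (?h p) \<le> B * C"
        unfolding real_norm_def abs_mult by (intro mult_mono u_le v_le) auto
    qed
  qed
  have "expectation (\<lambda>\<omega>. u (X i \<omega>) (X j \<omega>) * v (X k \<omega>) (X l \<omega>))
      = expectation (\<lambda>\<omega>. ?h (?Y \<omega>, ?Z \<omega>))" by simp
  also have "\<dots> = (\<integral>p. ?h p \<partial>(Q \<Otimes>\<^sub>M R))"
    unfolding joint[symmetric] by (rule integral_distr[symmetric]) (use h in simp_all)
  also have "\<dots> = (\<integral>a. (\<integral>b. ?h (a, b) \<partial>R) \<partial>Q)"
    using QR.integral_fst'[OF int] by simp
  also have "\<dots> = (\<integral>a. 0 \<partial>Q)"
  proof (rule Bochner_Integration.integral_cong[OF refl])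
    fix a assume "a \<in> space Q"
    then have a[measurable]: "a k \<in> space P" by (auto simp: Q_def space_PiM)
    have v_a: "v (a k) \<in> borel_measurable P"
      using measurable_compose[of "\<lambda>y. (a k, y)" P "P \<Otimes>\<^sub>M P" "\<lambda>(x, y). v x y" borel] a by simp
    have "(\<lambda>b. b l) \<in> measurable (PiM {l} (\<lambda>_. P)) P"
      by (rule measurable_component_singleton) simp
    then have "(\<integral>b. v (a k) (b l) \<partial>R) = expectation (\<lambda>\<omega>. v (a k) (X l \<omega>))"
      unfolding R_def using measurable_compose[OF _ v_a] by (subst integral_distr) auto
    then show "(\<integral>b. ?h (a, b) \<partial>R) = 0" using v_0[OF a] expectation_X[OF v_a] by simp
  qed
  finally show ?thesis by simp
qed

lemma expectation_square_iid_sum: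
  fixes r :: "'b \<Rightarrow> real"
  assumes [measurable]: "r \<in> borel_measurable P"
    and r_le: "\<And>x. \<bar>r x\<bar> \<le> B" and r_0: "(\<integral>x. r x \<partial>P) = 0"
  shows "expectation (\<lambda>\<omega>. (\<Sum>i<n. r (X i \<omega>))\<^sup>2) = real n * (\<integral>x. (r x)\<^sup>2 \<partial>P)"
proof -
  have "expectation (\<lambda>\<omega>. (\<Sum>i<n. r (X i \<omega>))\<^sup>2) = (\<Sum>i<n. expectation (\<lambda>\<omega>. (r (X i \<omega>))\<^sup>2))"
  proof (rule integral_square_sum_orthogonal)
    fix i j
    have "norm (r x * r y) \<le> B * B" for x y
      using r_le[of x] r_le[of y] by (auto simp: abs_mult intro!: mult_mono)
    then show "integrable M (\<lambda>\<omega>. r (X i \<omega>) * r (X j \<omega>))"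
      by (intro integrable_const_bound[where B = "B * B"]) auto
    assume "i \<noteq> j"
    then have "j \<notin> {i, i, i}" by simp
    with r_0 show "expectation (\<lambda>\<omega>. r (X i \<omega>) * r (X j \<omega>)) = 0"
      by (intro expectation_mult_degenerate[where u = "\<lambda>x _. r x" and v = "\<lambda>_ y. r y", OF _ _ r_le r_le])
         measurable
  qed simp
  then show ?thesis by (simp add: expectation_X[of "\<lambda>x. (r x)\<^sup>2"])
qed

text \<open>Two different pairs never consist of the same two indices, so one of them contains an
  index that is missing from the other, and the corresponding product has expectation 0.
  Only the at most \<open>n^2\<close> diagonal terms remain of the \<open>n^4\<close> products.\<close>

lemma expectation_square_degenerate_pair_sum_le:
  fixes v :: "'b \<Rightarrow> 'b \<Rightarrow> real"
  assumes v[measurable]: "(\<lambda>(x, y). v x y) \<in> borel_measurable (P \<Otimes>\<^sub>M P)"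
    and v_le: "\<And>x y. \<bar>v x y\<bar> \<le> C" and sym: "\<And>x y. v x y = v y x"
    and v_0: "\<And>x. x \<in> space P \<Longrightarrow> (\<integral>y. v x y \<partial>P) = 0"
  shows "expectation (\<lambda>\<omega>. (\<Sum>j<n. \<Sum>i<j. v (X i \<omega>) (X j \<omega>))\<^sup>2) \<le> (real n)\<^sup>2 * C\<^sup>2"
proof -
  define S where "S = Sigma {..<n} (\<lambda>j. {..<j})"
  define Z where "Z = (\<lambda>(j, i) \<omega>. v (X i \<omega>) (X j \<omega>))"
  have [measurable]: "(\<lambda>\<omega>. v (X i \<omega>) (X j \<omega>)) \<in> borel_measurable M" for i j
    using measurable_compose[of "\<lambda>\<omega>. (X i \<omega>, X j \<omega>)" M "P \<Otimes>\<^sub>M P" "\<lambda>(x, y). v x y" borel] by simp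
  have "finite S" by (simp add: S_def)
  have "0 \<le> C" using order_trans[OF abs_ge_zero v_le] .
  have vv: "norm (v x y * v x' y') \<le> C * C" for x y x' y'
    using v_le \<open>0 \<le> C\<close> by (auto simp: abs_mult intro!: mult_mono)
  have "expectation (\<lambda>\<omega>. (\<Sum>j<n. \<Sum>i<j. v (X i \<omega>) (X j \<omega>))\<^sup>2)
      = expectation (\<lambda>\<omega>. (\<Sum>s\<in>S. Z s \<omega>)\<^sup>2)"
    by (simp add: S_def Z_def sum.Sigma case_prod_beta)
  also have "\<dots> = (\<Sum>s\<in>S. expectation (\<lambda>\<omega>. (Z s \<omega>)\<^sup>2))"
  proof (rule integral_square_sum_orthogonal[OF \<open>finite S\<close>])
    fix s t assume st: "s \<in> S" "t \<in> S"
    obtain j i l k where [simp]: "s = (j, i)" "t = (l, k)" by (cases s, cases t) auto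
    have "i < j" "k < l" using st by (auto simp: S_def)
    show "integrable M (\<lambda>\<omega>. Z s \<omega> * Z t \<omega>)"
      using vv by (intro integrable_const_bound[where B = "C * C"]) (auto simp: Z_def)
    assume "s \<noteq> t"
    \<comment> \<open>If the larger index \<open>l\<close> occurs in \<open>{i, j}\<close>, then \<open>k\<close> does not: for \<open>l = i\<close> because \<open>k < i < j\<close>, for \<open>l = j\<close> because the pairs differ.\<close>
    then consider "l \<notin> {i, j, k}" | "k \<notin> {i, j, l}"
      using \<open>i < j\<close> \<open>k < l\<close> by fastforce
    then show "expectation (\<lambda>\<omega>. Z s \<omega> * Z t \<omega>) = 0"
    proof cases
      case 1
      then show ?thesis
        using expectation_mult_degenerate[OF v v v_le v_le v_0 1] by (simp add: Z_def)
    next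
      case 2
      then show ?thesis
        using expectation_mult_degenerate[OF v v v_le v_le v_0 2]
        by (simp add: Z_def sym[of "X l _" "X k _"])
    qed
  qed
  also have "\<dots> \<le> (\<Sum>s\<in>S. C\<^sup>2)"
  proof (rule sum_mono)
    fix s
    have "norm ((Z s \<omega>)\<^sup>2) \<le> C\<^sup>2" for \<omega>
      using vv[of "X (snd s) \<omega>" "X (fst s) \<omega>" "X (snd s) \<omega>" "X (fst s) \<omega>"]
      by (simp add: Z_def power2_eq_square case_prod_beta)
    moreover have "Z s \<in> borel_measurable M" by (cases s) (simp add: Z_def)
    ultimately have "integrable M (\<lambda>\<omega>. (Z s \<omega>)\<^sup>2)" "\<And>\<omega>. (Z s \<omega>)\<^sup>2 \<le> C\<^sup>2"
      by (auto intro!: integrable_const_bound[where B = "C\<^sup>2"])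
    then show "expectation (\<lambda>\<omega>. (Z s \<omega>)\<^sup>2) \<le> C\<^sup>2"
      by (intro integral_le_const) auto
  qed
  also have "\<dots> = real (card S) * C\<^sup>2" by simp
  also have "\<dots> \<le> (real n)\<^sup>2 * C\<^sup>2"
  proof (rule mult_right_mono)
    have "S \<subseteq> {..<n} \<times> {..<n}" by (auto simp: S_def)
    then have "card S \<le> n * n" using card_mono[of "{..<n} \<times> {..<n}" S] by simp
    then show "real (card S) \<le> (real n)\<^sup>2" by (simp add: power2_eq_square flip: of_nat_mult)
  qed simp
  finally show ?thesis .
qed

end

section \<open>Central limit theorem for U-statistics with a varying kernel\<close>

lemma (in prob_space) abs_integral_le_bound:
  fixes f :: "'a \<Rightarrow> real"
  assumes f_le: "\<And>x. \<bar>f x\<bar> \<le> B"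
  shows "\<bar>\<integral>x. f x \<partial>M\<bar> \<le> B"
proof (cases "integrable M f")
  case True
  have "\<bar>\<integral>x. f x \<partial>M\<bar> \<le> (\<integral>x. \<bar>f x\<bar> \<partial>M)" by (rule integral_abs_bound)
  also have "\<dots> \<le> B" using True f_le by (intro integral_le_const) auto
  finally show ?thesis .
next
  case False
  then show ?thesis
    using order_trans[OF abs_ge_zero f_le] by (simp add: not_integrable_integral_eq)
qed

lemma sum_pairs_add:
  fixes a :: "nat \<Rightarrow> real"
  shows "(\<Sum>j<n. \<Sum>i<j. a i + a j) = (real n - 1) * (\<Sum>i<n. a i)"
proof (induction n)
  case (Suc n)
  have "(\<Sum>j<Suc n. \<Sum>i<j. a i + a j) = (\<Sum>j<n. \<Sum>i<j. a i + a j) + ((\<Sum>i<n. a i) + real n * a n)"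
    by (simp add: sum.distrib)
  then show ?case unfolding Suc.IH by (simp add: algebra_simps)
qed simp

lemma sum_pairs_const:
  fixes c :: real
  shows "(\<Sum>j<n. \<Sum>i<j. c) = real n * (real n - 1) / 2 * c"
  using sum_pairs_add[of "\<lambda>_. c / 2" n] by simp

context iid_sequence
begin

text \<open>Only the projections \<open>E (\<phi> n x (X 0))\<close> have to converge, since all other parts of the
  kernels contribute to lower order, whatever bounded kernels are used.\<close>

theorem triangular_U_statistic_asymptotically_normal:
  fixes \<phi> :: "nat \<Rightarrow> 'b \<Rightarrow> 'b \<Rightarrow> real" and g :: "'b \<Rightarrow> real"
  assumes \<phi>[measurable]: "\<And>n. (\<lambda>(x, y). \<phi> n x y) \<in> borel_measurable (P \<Otimes>\<^sub>M P)"
    and sym: "\<And>n x y. \<phi> n x y = \<phi> n y x"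
    and \<phi>_le: "\<And>n x y. \<bar>\<phi> n x y\<bar> \<le> B"
    and conv: "\<And>x. (\<lambda>n. \<integral>y. \<phi> n x y \<partial>P) \<longlonglongrightarrow> g x"
    and nonconst: "\<And>c. \<not> (AE x in P. g x = c)"
  defines "W \<equiv> \<lambda>n \<omega>. \<Sum>j<n. \<Sum>i\<le>j. \<phi> n (X i \<omega>) (X j \<omega>)"
  shows "weak_conv_m
    (\<lambda>n. distr M borel (\<lambda>\<omega>. (W n \<omega> - expectation (W n)) / sqrt (variance (W n))))
    std_normal_distribution"
proof -
  \<comment> \<open>\<open>\<gamma> n\<close> is the centered projection of \<open>\<phi> n\<close> and \<open>v n\<close> its completely degenerate part; \<open>r n\<close> collects the diagonal terms and the error from replacing \<open>(n - 1) * \<gamma> n\<close> by \<open>n * \<gamma>\'\<close>.\<close>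
  define p where "p n x = (\<integral>y. \<phi> n x y \<partial>P)" for n x
  define \<mu> where "\<mu> n = (\<integral>x. p n x \<partial>P)" for n
  define \<mu>' where "\<mu>' = (\<integral>x. g x \<partial>P)"
  define d where "d n = (\<integral>x. \<phi> n x x \<partial>P)" for n
  define \<gamma> where "\<gamma> n x = p n x - \<mu> n" for n x
  define \<gamma>' where "\<gamma>' x = g x - \<mu>'" for x
  define v where "v n x y = \<phi> n x y - \<mu> n - (\<gamma> n x + \<gamma> n y)" for n x y
  define r where "r n x = (real n - 1) * \<gamma> n x - real n * \<gamma>' x + (\<phi> n x x - d n)" for n x
  define G where "G n \<omega> = (\<Sum>i<n. \<gamma>' (X i \<omega>))" for n \<omega>
  define V where "V n \<omega> = (\<Sum>j<n. \<Sum>i<j. v n (X i \<omega>) (X j \<omega>))" for n \<omega>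
  define R where "R n \<omega> = (\<Sum>i<n. r n (X i \<omega>))" for n \<omega>
  define C where "C n = real n * (real n - 1) / 2 * \<mu> n + real n * d n" for n

  have B: "0 \<le> B" by (rule order_trans[OF abs_ge_zero \<phi>_le])
  have p_le: "\<bar>p n x\<bar> \<le> B" for n x
    unfolding p_def by (intro P.abs_integral_le_bound \<phi>_le)
  have g_le: "\<bar>g x\<bar> \<le> B" for x
    using LIMSEQ_le_const2[OF tendsto_rabs[OF conv]] p_le by (auto simp: p_def)
  have \<mu>_le: "\<bar>\<mu> n\<bar> \<le> B" "\<bar>\<mu>'\<bar> \<le> B" "\<bar>d n\<bar> \<le> B" for n
    unfolding \<mu>_def \<mu>'_def d_def by (intro P.abs_integral_le_bound p_le g_le \<phi>_le)+
  have \<gamma>_le: "\<bar>\<gamma> n x\<bar> \<le> 2 * B" "\<bar>\<gamma>' x\<bar> \<le> 2 * B" for n x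
    using p_le[of n x] g_le[of x] \<mu>_le(1)[of n] \<mu>_le(2) by (auto simp: \<gamma>_def \<gamma>'_def)
  have v_le: "\<bar>v n x y\<bar> \<le> 6 * B" for n x y
    using \<phi>_le[of n x y] \<mu>_le(1)[of n] \<gamma>_le(1)[of n x] \<gamma>_le(1)[of n y] by (auto simp: v_def)

  have p[measurable]: "p n \<in> borel_measurable P" for n
    unfolding p_def using P.borel_measurable_lebesgue_integral[OF \<phi>] by simp
  have g[measurable]: "g \<in> borel_measurable P"
    by (rule borel_measurable_LIMSEQ_real[OF conv]) (use p in \<open>simp add: p_def[abs_def]\<close>)
  have \<gamma>[measurable]: "\<gamma> n \<in> borel_measurable P" "\<gamma>' \<in> borel_measurable P" for n
    by (simp_all add: \<gamma>_def[abs_def] \<gamma>'_def[abs_def])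
  have v[measurable]: "(\<lambda>(x, y). v n x y) \<in> borel_measurable (P \<Otimes>\<^sub>M P)" for n
  proof -
    have "(\<lambda>z. (\<lambda>(x, y). \<phi> n x y) z - \<mu> n - (\<gamma> n (fst z) + \<gamma> n (snd z))) \<in> borel_measurable (P \<Otimes>\<^sub>M P)"
      by measurable
    then show ?thesis by (simp add: v_def case_prod_beta)
  qed
  have \<phi>_diag[measurable]: "(\<lambda>x. \<phi> n x x) \<in> borel_measurable P" for n
    using measurable_compose[of "\<lambda>x. (x, x)" P "P \<Otimes>\<^sub>M P" "\<lambda>(x, y). \<phi> n x y" borel] by simp
  have \<phi>_sec: "\<phi> n x \<in> borel_measurable P" if "x \<in> space P" for n x
    using measurable_compose[of "\<lambda>y. (x, y)" P "P \<Otimes>\<^sub>M P" "\<lambda>(x, y). \<phi> n x y" borel] that by simp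
  have r[measurable]: "r n \<in> borel_measurable P" for n
    by (simp add: r_def[abs_def])
  have vX[measurable]: "(\<lambda>\<omega>. v n (X i \<omega>) (X j \<omega>)) \<in> borel_measurable M" for n i j
    using measurable_compose[of "\<lambda>\<omega>. (X i \<omega>, X j \<omega>)" M "P \<Otimes>\<^sub>M P" "\<lambda>(x, y). v n x y" borel] by simp
  have GVR[measurable]: "G n \<in> borel_measurable M" "V n \<in> borel_measurable M" "R n \<in> borel_measurable M" for n
    by (simp_all add: G_def[abs_def] V_def[abs_def] R_def[abs_def])

  have P_bounded: "integrable P f" if "f \<in> borel_measurable P" "\<And>x. \<bar>f x\<bar> \<le> K" for f :: "'b \<Rightarrow> real" and K
    using that by (auto intro!: P.integrable_const_bound[where B = K])
  have int: "integrable P (p n)" "integrable P g" "integrable P (\<gamma> n)" "integrable P \<gamma>'"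
    "integrable P (\<lambda>x. \<phi> n x x)" for n
    by (rule P_bounded[OF p p_le] P_bounded[OF g g_le] P_bounded[OF \<gamma>(1) \<gamma>_le(1)]
      P_bounded[OF \<gamma>(2) \<gamma>_le(2)] P_bounded[OF \<phi>_diag \<phi>_le])+
  have int_\<phi>: "integrable P (\<phi> n x)" if "x \<in> space P" for n x
    by (rule P_bounded[OF \<phi>_sec[OF that] \<phi>_le])
  have \<gamma>_0: "(\<integral>x. \<gamma> n x \<partial>P) = 0" "(\<integral>x. \<gamma>' x \<partial>P) = 0" for n
    using int by (simp_all add: \<gamma>_def[abs_def] \<gamma>'_def[abs_def] \<mu>_def \<mu>'_def P.prob_space)
  have v_0: "(\<integral>y. v n x y \<partial>P) = 0" if "x \<in> space P" for n x
    using int int_\<phi>[OF that] \<gamma>_0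
    by (simp add: v_def P.prob_space) (simp add: \<gamma>_def p_def)
  have r_0: "(\<integral>x. r n x \<partial>P) = 0" for n
    using int \<gamma>_0 by (simp add: r_def P.prob_space d_def)
  have v_sym: "v n x y = v n y x" for n x y
    using sym[of n x y] by (simp add: v_def)

  have decomposition: "W n \<omega> = C n + real n * G n \<omega> + (V n \<omega> + R n \<omega>)" for n \<omega>
  proof -
    have "W n \<omega> = (\<Sum>j<n. \<Sum>i<j. v n (X i \<omega>) (X j \<omega>) + \<mu> n + (\<gamma> n (X i \<omega>) + \<gamma> n (X j \<omega>)))
        + (\<Sum>j<n. \<phi> n (X j \<omega>) (X j \<omega>))"
      by (simp add: W_def v_def sum.distrib flip: lessThan_Suc_atMost)
    also have "\<dots> = V n \<omega> + real n * (real n - 1) / 2 * \<mu> n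
        + (real n - 1) * (\<Sum>i<n. \<gamma> n (X i \<omega>)) + (\<Sum>j<n. \<phi> n (X j \<omega>) (X j \<omega>))"
      using sum_pairs_add[of "\<lambda>i. \<gamma> n (X i \<omega>)" n] sum_pairs_const[of "\<mu> n" n]
      by (simp add: V_def sum.distrib)
    also have "\<dots> = C n + real n * G n \<omega> + (V n \<omega> + R n \<omega>)"
      by (simp add: C_def R_def r_def G_def sum.distrib sum_subtractf flip: sum_distrib_left)
    finally show ?thesis .
  qed

  have r_le: "\<bar>r n x\<bar> \<le> (real n + 1) * (2 * B) + real n * (2 * B) + 2 * B" for n x
  proof -
    have "\<bar>r n x\<bar> \<le> \<bar>(real n - 1) * \<gamma> n x\<bar> + \<bar>real n * \<gamma>' x\<bar> + (\<bar>\<phi> n x x\<bar> + \<bar>d n\<bar>)"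
      unfolding r_def by linarith
    also have "\<dots> \<le> (real n + 1) * (2 * B) + real n * (2 * B) + (B + B)"
      unfolding abs_mult using \<gamma>_le(1)[of n x] \<gamma>_le(2)[of x] \<phi>_le \<mu>_le B
      by (intro add_mono mult_mono) auto
    finally show ?thesis by simp
  qed
  have G_le: "\<bar>G n \<omega>\<bar> \<le> real n * (2 * B)" for n \<omega>
  proof -
    have "\<bar>G n \<omega>\<bar> \<le> (\<Sum>i<n. 2 * B)"
      unfolding G_def by (intro order_trans[OF sum_abs] sum_mono \<gamma>_le(2))
    then show ?thesis by simp
  qed
  have bounded_R: "\<exists>K. \<forall>\<omega>. \<bar>R n \<omega>\<bar> \<le> K" for n
    unfolding R_def
    by (rule exI[of _ "\<Sum>i<n. (real n + 1) * (2 * B) + real n * (2 * B) + 2 * B"])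
      (intro allI order_trans[OF sum_abs] sum_mono r_le)
  have bounded_V: "\<exists>K. \<forall>\<omega>. \<bar>V n \<omega>\<bar> \<le> K" for n
    unfolding V_def
    by (rule exI[of _ "\<Sum>j<n. \<Sum>i<j. 6 * B"])
      (intro allI order_trans[OF sum_abs] sum_mono v_le)
  have integrable_bounded: "integrable M f"
    if "f \<in> borel_measurable M" "\<exists>K. \<forall>\<omega>. \<bar>f \<omega>\<bar> \<le> K" for f :: "'a \<Rightarrow> real"
  proof -
    from that obtain K where "\<bar>f \<omega>\<bar> \<le> K" for \<omega> by auto
    with that show ?thesis by (intro integrable_const_bound[where B = K]) auto
  qed
  have sq_bounded: "\<exists>K. \<forall>\<omega>. \<bar>(f \<omega>)\<^sup>2\<bar> \<le> K" if "\<exists>K. \<forall>\<omega>. \<bar>f \<omega>\<bar> \<le> K" for f :: "'a \<Rightarrow> real"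
  proof -
    from that obtain K where "\<bar>f \<omega>\<bar> \<le> K" for \<omega> by auto
    then have "\<bar>(f \<omega>)\<^sup>2\<bar> \<le> K\<^sup>2" for \<omega>
      using power_mono[of "\<bar>f \<omega>\<bar>" K 2] by simp
    then show ?thesis by blast
  qed
  have int_M: "integrable M (G n)" "integrable M (V n)" "integrable M (R n)"
     "integrable M (\<lambda>\<omega>. (G n \<omega>)\<^sup>2)" "integrable M (\<lambda>\<omega>. (V n \<omega>)\<^sup>2)" "integrable M (\<lambda>\<omega>. (R n \<omega>)\<^sup>2)" for n
    using G_le bounded_R bounded_V by (auto intro!: integrable_bounded sq_bounded)
  have int_VR2: "integrable M (\<lambda>\<omega>. (V n \<omega> + R n \<omega>)\<^sup>2)"
    and int_GVR2: "integrable M (\<lambda>\<omega>. (real n * G n \<omega> + (V n \<omega> + R n \<omega>))\<^sup>2)" for n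
  proof -
    obtain K1 K2 where K: "\<bar>R n \<omega>\<bar> \<le> K1" "\<bar>V n \<omega>\<bar> \<le> K2" for \<omega>
      using bounded_R bounded_V by blast
    have "\<bar>V n \<omega> + R n \<omega>\<bar> \<le> K2 + K1" for \<omega>
      using K[of \<omega>] by linarith
    then show "integrable M (\<lambda>\<omega>. (V n \<omega> + R n \<omega>)\<^sup>2)"
      by (intro integrable_bounded sq_bounded) auto
    have "\<bar>real n * G n \<omega> + (V n \<omega> + R n \<omega>)\<bar> \<le> real n * (real n * (2 * B)) + (K2 + K1)" for \<omega>
    proof -
      have "\<bar>real n * G n \<omega>\<bar> \<le> real n * (real n * (2 * B))"
        unfolding abs_mult using G_le by (intro mult_mono) auto
      then show ?thesis using K[of \<omega>] by linarith
    qed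
    then show "integrable M (\<lambda>\<omega>. (real n * G n \<omega> + (V n \<omega> + R n \<omega>))\<^sup>2)"
      by (intro integrable_bounded sq_bounded) auto
  qed

  have int_r: "integrable P (r n)" for n
    using int by (simp add: r_def[abs_def])
  have "expectation (G n) = 0" for n
  proof -
    have "integrable M (\<lambda>\<omega>. \<gamma>' (X i \<omega>))" for i
      using \<gamma>_le by (auto intro!: integrable_const_bound[where B = "2 * B"])
    then show ?thesis by (simp add: G_def[abs_def] expectation_X \<gamma>_0)
  qed
  moreover have "expectation (R n) = 0" for n
  proof -
    have "integrable M (\<lambda>\<omega>. r n (X i \<omega>))" for i
      using r_le by (intro integrable_bounded) auto
    then show ?thesis by (simp add: R_def[abs_def] expectation_X r_0)
  qed
  moreover have "expectation (V n) = 0" for n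
  proof -
    have "expectation (\<lambda>\<omega>. v n (X i \<omega>) (X j \<omega>)) = 0" if "i < j" for i j
      using expectation_mult_degenerate[of "\<lambda>_ _. 1" "v n" 1 "6 * B" j i i i] v v_le v_0 that by simp
    moreover have "integrable M (\<lambda>\<omega>. v n (X i \<omega>) (X j \<omega>))" for i j
      using v_le by (intro integrable_bounded) auto
    ultimately show ?thesis by (simp add: V_def[abs_def])
  qed
  ultimately have "expectation (W n) = C n" for n
    using int_M unfolding decomposition[abs_def] by (simp add: prob_space)
  then have centered: "W n \<omega> - expectation (W n) = real n * G n \<omega> + (V n \<omega> + R n \<omega>)" for n \<omega>
    by (simp add: decomposition)

  have \<gamma>_conv: "(\<lambda>n. \<integral>x. (\<gamma> n x - \<gamma>' x)\<^sup>2 \<partial>P) \<longlonglongrightarrow> 0"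
  proof -
    have "\<mu> \<longlonglongrightarrow> \<mu>'"
      unfolding \<mu>_def \<mu>'_def using conv p_le
      by (intro integral_dominated_convergence[where w = "\<lambda>_. B"]) (auto simp: p_def[abs_def])
    then have "(\<lambda>n. (\<gamma> n x - \<gamma>' x)\<^sup>2) \<longlonglongrightarrow> ((g x - \<mu>') - \<gamma>' x)\<^sup>2" for x
      unfolding \<gamma>_def p_def by (intro tendsto_intros conv)
    moreover have "(\<gamma> n x - \<gamma>' x)\<^sup>2 \<le> (4 * B)\<^sup>2" for n x
      using power_mono[of "\<bar>\<gamma> n x - \<gamma>' x\<bar>" "4 * B" 2] \<gamma>_le(1)[of n x] \<gamma>_le(2)[of x] by auto
    ultimately have "(\<lambda>n. \<integral>x. (\<gamma> n x - \<gamma>' x)\<^sup>2 \<partial>P) \<longlonglongrightarrow> (\<integral>x. 0 \<partial>P)"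
      by (intro integral_dominated_convergence[where w = "\<lambda>_. (4 * B)\<^sup>2"]) (auto simp: \<gamma>'_def)
    then show ?thesis by simp
  qed

  define \<sigma> where "\<sigma> = sqrt (\<integral>x. (\<gamma>' x)\<^sup>2 \<partial>P)"
  have int_\<gamma>2: "integrable P (\<lambda>x. (\<gamma>' x)\<^sup>2)"
  proof (rule P_bounded)
    show "\<bar>(\<gamma>' x)\<^sup>2\<bar> \<le> (2 * B)\<^sup>2" for x
      using power_mono[OF \<gamma>_le(2)[of x] abs_ge_zero, of 2] by simp
  qed simp
  have \<sigma>_sq: "\<sigma>\<^sup>2 = (\<integral>x. (\<gamma>' x)\<^sup>2 \<partial>P)" by (simp add: \<sigma>_def)
  have "(\<integral>x. (\<gamma>' x)\<^sup>2 \<partial>P) \<noteq> 0"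
  proof
    assume "(\<integral>x. (\<gamma>' x)\<^sup>2 \<partial>P) = 0"
    then have "AE x in P. (\<gamma>' x)\<^sup>2 = 0"
      using int_\<gamma>2 by (subst (asm) integral_nonneg_eq_0_iff_AE) auto
    then have "AE x in P. g x = \<mu>'" by (simp add: \<gamma>'_def)
    with nonconst show False by blast
  qed
  then have \<sigma>: "\<sigma> > 0"
    by (simp add: \<sigma>_def order_less_le)

  have CLT: "weak_conv_m (\<lambda>n. distr M borel (\<lambda>\<omega>. G n \<omega> / sqrt (real n * \<sigma>\<^sup>2))) std_normal_distribution"
    unfolding G_def
  proof (rule central_limit_theorem_zero_mean[where \<mu> = "distr P borel \<gamma>'"])
    show "indep_vars (\<lambda>i. borel) (\<lambda>i \<omega>. \<gamma>' (X i \<omega>)) UNIV"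
      by (rule indep_vars_compose2[OF indep]) simp
    show E0: "expectation (\<lambda>\<omega>. \<gamma>' (X i \<omega>)) = 0" for i
      by (simp add: expectation_X \<gamma>_0)
    have "\<bar>\<gamma>' x\<bar>\<^sup>2 \<le> (2 * B)\<^sup>2" for x
      by (intro power_mono \<gamma>_le) simp
    then show "integrable M (\<lambda>\<omega>. (\<gamma>' (X i \<omega>))\<^sup>2)" for i
      by (intro integrable_bounded) auto
    show "variance (\<lambda>\<omega>. \<gamma>' (X i \<omega>)) = \<sigma>\<^sup>2" for i
      unfolding E0 \<sigma>_sq by (simp add: expectation_X[of "\<lambda>x. (\<gamma>' x)\<^sup>2"])
    show "distr M borel (\<lambda>\<omega>. \<gamma>' (X i \<omega>)) = distr P borel \<gamma>'" for i
      using distr_distr[of \<gamma>' P borel "X i" M] by (simp add: distr_X o_def)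
  qed (rule \<sigma>)

  \<comment> \<open>The factor \<open>n\<close> of the main part times the scale \<open>sqrt n\<close> of the central limit theorem.\<close>
  define \<beta> where "\<beta> n = real n * sqrt (real n)" for n
  have \<beta>_sq: "(\<beta> n)\<^sup>2 = (real n)^3" for n
    by (simp add: \<beta>_def power_mult_distrib power2_eq_square power3_eq_cube)
  define A where "A n \<omega> = real n * G n \<omega> / \<beta> n" for n \<omega>
  define U where "U n \<omega> = (W n \<omega> - expectation (W n)) / \<beta> n" for n \<omega>

  have remainder: "expectation (\<lambda>\<omega>. (V n \<omega> + R n \<omega>)\<^sup>2)
      \<le> 72 * B\<^sup>2 * (real n)\<^sup>2 + 4 * real n ^ 3 * (\<integral>x. (\<gamma> n x - \<gamma>' x)\<^sup>2 \<partial>P) + 64 * B\<^sup>2 * real n" for n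
  proof -
    have sq_add: "(a + b)\<^sup>2 \<le> 2 * a\<^sup>2 + 2 * b\<^sup>2" for a b :: real
      using zero_le_power2[of "a - b"] by (simp add: power2_eq_square algebra_simps)
    have int_diff2: "integrable P (\<lambda>x. (\<gamma> n x - \<gamma>' x)\<^sup>2)"
    proof (rule P_bounded)
      have "\<bar>\<gamma> n x - \<gamma>' x\<bar>\<^sup>2 \<le> (4 * B)\<^sup>2" for x
        using \<gamma>_le(1)[of n x] \<gamma>_le(2)[of x] by (intro power_mono) auto
      then show "\<bar>(\<gamma> n x - \<gamma>' x)\<^sup>2\<bar> \<le> (4 * B)\<^sup>2" for x by simp
    qed simp
    have r_sq: "(r n x)\<^sup>2 \<le> 2 * (real n)\<^sup>2 * (\<gamma> n x - \<gamma>' x)\<^sup>2 + 32 * B\<^sup>2" for x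
    proof -
      have "r n x = real n * (\<gamma> n x - \<gamma>' x) + (\<phi> n x x - d n - \<gamma> n x)"
        by (simp add: r_def algebra_simps)
      moreover have "\<bar>\<phi> n x x - d n - \<gamma> n x\<bar> \<le> 4 * B"
        using \<phi>_le[of n x x] \<mu>_le(3)[of n] \<gamma>_le(1)[of n x] by linarith
      then have "(\<phi> n x x - d n - \<gamma> n x)\<^sup>2 \<le> (4 * B)\<^sup>2"
        using power_mono[of "\<bar>\<phi> n x x - d n - \<gamma> n x\<bar>" "4 * B" 2] by simp
      ultimately show ?thesis
        using sq_add[of "real n * (\<gamma> n x - \<gamma>' x)" "\<phi> n x x - d n - \<gamma> n x"]
        by (simp add: power_mult_distrib)
    qed
    define \<delta> where "\<delta> = (\<integral>x. (\<gamma> n x - \<gamma>' x)\<^sup>2 \<partial>P)"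
    have "(\<integral>x. (r n x)\<^sup>2 \<partial>P) \<le> (\<integral>x. 2 * (real n)\<^sup>2 * (\<gamma> n x - \<gamma>' x)\<^sup>2 + 32 * B\<^sup>2 \<partial>P)"
    proof (rule integral_mono)
      show int_bd: "integrable P (\<lambda>x. 2 * (real n)\<^sup>2 * (\<gamma> n x - \<gamma>' x)\<^sup>2 + 32 * B\<^sup>2)"
        using int_diff2 by simp
      show "integrable P (\<lambda>x. (r n x)\<^sup>2)"
        by (rule Bochner_Integration.integrable_bound[OF int_bd])
          (use r_sq in \<open>auto intro!: AE_I2 order_trans[OF r_sq]\<close>)
    qed (rule r_sq)
    also have "\<dots> = 2 * (real n)\<^sup>2 * \<delta> + 32 * B\<^sup>2"
      using int_diff2 by (simp add: P.prob_space \<delta>_def)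
    finally have "real n * (\<integral>x. (r n x)\<^sup>2 \<partial>P) \<le> real n * (2 * (real n)\<^sup>2 * \<delta> + 32 * B\<^sup>2)"
      by (rule mult_left_mono) simp
    moreover have "expectation (\<lambda>\<omega>. (R n \<omega>)\<^sup>2) = real n * (\<integral>x. (r n x)\<^sup>2 \<partial>P)"
      unfolding R_def by (intro expectation_square_iid_sum[OF _ r_le r_0]) simp
    moreover have "expectation (\<lambda>\<omega>. (V n \<omega>)\<^sup>2) \<le> (real n)\<^sup>2 * (6 * B)\<^sup>2"
      unfolding V_def by (intro expectation_square_degenerate_pair_sum_le v v_le v_sym v_0)
    moreover have "expectation (\<lambda>\<omega>. (V n \<omega> + R n \<omega>)\<^sup>2)
        \<le> expectation (\<lambda>\<omega>. 2 * (V n \<omega>)\<^sup>2 + 2 * (R n \<omega>)\<^sup>2)"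
      using int_M int_VR2 by (intro integral_mono sq_add) auto
    moreover have "\<dots> = 2 * expectation (\<lambda>\<omega>. (V n \<omega>)\<^sup>2) + 2 * expectation (\<lambda>\<omega>. (R n \<omega>)\<^sup>2)"
      using int_M by simp
    ultimately have "expectation (\<lambda>\<omega>. (V n \<omega> + R n \<omega>)\<^sup>2)
        \<le> 2 * ((real n)\<^sup>2 * (6 * B)\<^sup>2) + 2 * (real n * (2 * (real n)\<^sup>2 * \<delta> + 32 * B\<^sup>2))"
      by linarith
    also have "\<dots> = 72 * B\<^sup>2 * (real n)\<^sup>2 + 4 * real n ^ 3 * \<delta> + 64 * B\<^sup>2 * real n"
      by (simp add: power2_eq_square power3_eq_cube algebra_simps)
    finally show ?thesis unfolding \<delta>_def .
  qed

  have "weak_conv_m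
    (\<lambda>n. distr M borel (\<lambda>\<omega>. U n \<omega> / sqrt (expectation (\<lambda>\<omega>. (U n \<omega>)\<^sup>2)))) std_normal_distribution"
  proof (rule weak_conv_m_L2_close_normalized[where A = A, OF _ _ _ _ \<sigma>])
    show "A n \<in> borel_measurable M" "U n \<in> borel_measurable M" for n
      by (simp_all add: A_def[abs_def] U_def[abs_def] centered)
    show "integrable M (\<lambda>\<omega>. (A n \<omega>)\<^sup>2)" for n
      using int_M by (simp add: A_def power_divide power_mult_distrib)
    show "integrable M (\<lambda>\<omega>. (U n \<omega>)\<^sup>2)" for n
      using int_GVR2 by (simp add: U_def centered power_divide)
    have "expectation (\<lambda>\<omega>. (A n \<omega>)\<^sup>2) = \<sigma>\<^sup>2" if "n \<ge> 1" for n
    proof -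
      have "expectation (\<lambda>\<omega>. (G n \<omega>)\<^sup>2) = real n * \<sigma>\<^sup>2"
        unfolding G_def \<sigma>_sq by (rule expectation_square_iid_sum[OF _ \<gamma>_le(2) \<gamma>_0(2)]) simp
      then have "expectation (\<lambda>\<omega>. (A n \<omega>)\<^sup>2) = (real n)\<^sup>2 * (real n * \<sigma>\<^sup>2) / real n ^ 3"
        by (simp add: A_def power_divide power_mult_distrib \<beta>_sq)
      then show ?thesis
        using that by (simp add: power2_eq_square power3_eq_cube)
    qed
    then show "(\<lambda>n. expectation (\<lambda>\<omega>. (A n \<omega>)\<^sup>2)) \<longlonglongrightarrow> \<sigma>\<^sup>2"
      by (intro tendsto_eventually eventually_sequentiallyI)
    show "(\<lambda>n. expectation (\<lambda>\<omega>. (U n \<omega> - A n \<omega>)\<^sup>2)) \<longlonglongrightarrow> 0"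
    proof (rule Lim_null_comparison)
      show "(\<lambda>n. 72 * B\<^sup>2 * (1 / real n) + 4 * (\<integral>x. (\<gamma> n x - \<gamma>' x)\<^sup>2 \<partial>P)
          + 64 * B\<^sup>2 * (1 / real n * (1 / real n))) \<longlonglongrightarrow> 0"
        by (rule tendsto_eq_intros lim_1_over_n \<gamma>_conv refl | simp)+
      show "\<forall>\<^sub>F n in sequentially. norm (expectation (\<lambda>\<omega>. (U n \<omega> - A n \<omega>)\<^sup>2))
          \<le> 72 * B\<^sup>2 * (1 / real n) + 4 * (\<integral>x. (\<gamma> n x - \<gamma>' x)\<^sup>2 \<partial>P)
            + 64 * B\<^sup>2 * (1 / real n * (1 / real n))"
      proof (rule eventually_sequentiallyI[of 1])
        fix n :: nat assume n: "n \<ge> 1"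
        have "U n \<omega> - A n \<omega> = (V n \<omega> + R n \<omega>) / \<beta> n" for \<omega>
          by (simp add: U_def A_def centered add_divide_distrib)
        then have "expectation (\<lambda>\<omega>. (U n \<omega> - A n \<omega>)\<^sup>2)
            = expectation (\<lambda>\<omega>. (V n \<omega> + R n \<omega>)\<^sup>2) / real n ^ 3"
          by (simp add: power_divide \<beta>_sq)
        also have "\<dots> \<le> (72 * B\<^sup>2 * (real n)\<^sup>2 + 4 * real n ^ 3 * (\<integral>x. (\<gamma> n x - \<gamma>' x)\<^sup>2 \<partial>P)
            + 64 * B\<^sup>2 * real n) / real n ^ 3"
          by (intro divide_right_mono remainder) simp
        also have "\<dots> = 72 * B\<^sup>2 * (1 / real n) + 4 * (\<integral>x. (\<gamma> n x - \<gamma>' x)\<^sup>2 \<partial>P)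
            + 64 * B\<^sup>2 * (1 / real n * (1 / real n))"
          using n by (simp add: field_simps power2_eq_square power3_eq_cube)
        finally show "norm (expectation (\<lambda>\<omega>. (U n \<omega> - A n \<omega>)\<^sup>2))
          \<le> 72 * B\<^sup>2 * (1 / real n) + 4 * (\<integral>x. (\<gamma> n x - \<gamma>' x)\<^sup>2 \<partial>P)
            + 64 * B\<^sup>2 * (1 / real n * (1 / real n))" by simp
      qed
    qed
    show "real_distribution std_normal_distribution" by (rule real_dist_normal_dist)
    have "A n \<omega> / \<sigma> = G n \<omega> / sqrt (real n * \<sigma>\<^sup>2)" for n \<omega>
      using \<sigma> by (simp add: A_def \<beta>_def real_sqrt_mult)
    with CLT show "weak_conv_m (\<lambda>n. distr M borel (\<lambda>\<omega>. A n \<omega> / \<sigma>)) std_normal_distribution" by simp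
  qed
  moreover have "U n \<omega> / sqrt (expectation (\<lambda>\<omega>. (U n \<omega>)\<^sup>2))
      = (W n \<omega> - expectation (W n)) / sqrt (variance (W n))" for n \<omega>
  proof (cases "n = 0")
    case True
    then show ?thesis by (simp add: U_def W_def)
  next
    case False
    then have "\<beta> n > 0" by (simp add: \<beta>_def)
    then show ?thesis by (simp add: U_def power_divide real_sqrt_divide)
  qed
  ultimately show ?thesis by simp
qed

end

section \<open>Integrated kernels\<close>

lemma kernel_cdf_altdef: "kernel_cdf k t = (\<integral>u. indicator {..t} u * k u \<partial>lborel)"
  by (simp add: kernel_cdf_def set_lebesgue_integral_def)

lemma integrable_lborel_indicator_mult:
  fixes k :: "real \<Rightarrow> real"
  assumes "integrable lborel k" and "A \<in> sets borel"
  shows "integrable lborel (\<lambda>u. indicator A u * k u)"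
  using integrable_mult_indicator[of A lborel k] assms by simp

lemma abs_kernel_cdf_le:
  assumes "integrable lborel k"
  shows "\<bar>kernel_cdf k t\<bar> \<le> (\<integral>u. \<bar>k u\<bar> \<partial>lborel)"
proof -
  have "\<bar>kernel_cdf k t\<bar> \<le> (\<integral>u. \<bar>indicator {..t} u * k u\<bar> \<partial>lborel)"
    unfolding kernel_cdf_altdef by (rule integral_abs_bound)
  also have "\<dots> \<le> (\<integral>u. \<bar>k u\<bar> \<partial>lborel)"
  proof (rule integral_mono)
    show "integrable lborel (\<lambda>u. \<bar>indicator {..t} u * k u\<bar>)"
      by (intro integrable_abs integrable_lborel_indicator_mult assms) simp
    show "integrable lborel (\<lambda>u. \<bar>k u\<bar>)"
      using assms by (rule integrable_abs)
  qed (simp add: abs_mult mult_left_le_one_le)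
  finally show ?thesis .
qed

lemma borel_measurable_kernel_cdf:
  assumes [measurable]: "k \<in> borel_measurable borel"
  shows "kernel_cdf k \<in> borel_measurable borel"
proof -
  have "(\<lambda>t. \<integral>u. (if u \<le> t then 1 else 0) * k u \<partial>lborel) \<in> borel_measurable borel"
    by measurable
  also have "(\<lambda>t. \<integral>u. (if u \<le> t then 1 else 0) * k u \<partial>lborel) = kernel_cdf k"
  proof (rule ext)
    show "(\<integral>u. (if u \<le> t then 1 else 0) * k u \<partial>lborel) = kernel_cdf k t" for t
      unfolding kernel_cdf_altdef by (intro Bochner_Integration.integral_cong) auto
  qed
  finally show ?thesis .
qed

lemma kernel_cdf_at_top:
  assumes "integrable lborel k"
  shows "(kernel_cdf k \<longlongrightarrow> (\<integral>u. k u \<partial>lborel)) at_top"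
  using tendsto_integral_at_top[OF sets_lborel assms] by (simp add: kernel_cdf_altdef[abs_def])

lemma kernel_cdf_at_bot:
  assumes k: "integrable lborel k"
  shows "(kernel_cdf k \<longlongrightarrow> 0) at_bot"
  unfolding filterlim_at_bot_mirror
proof -
  have [measurable]: "k \<in> borel_measurable borel"
    using borel_measurable_integrable[OF k] by simp
  have "((\<lambda>t. \<integral>u. indicator {..- t} u * k u \<partial>lborel) \<longlongrightarrow> (\<integral>u. 0 \<partial>(lborel :: real measure))) at_top"
  proof (rule integral_dominated_convergence_at_top[where w = "\<lambda>u. \<bar>k u\<bar>"])
    show "AE u in lborel. ((\<lambda>t. indicator {..- t} u * k u) \<longlongrightarrow> 0) at_top"
    proof (intro AE_I2 tendsto_eventually)
      show "\<forall>\<^sub>F t in at_top. indicator {..- t} u * k u = 0" for u :: real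
        using eventually_gt_at_top[of "- u"] by eventually_elim (simp add: indicator_def)
    qed
  next
    show "\<forall>\<^sub>F t in at_top. AE u in lborel. norm (indicator {..- t} u * k u) \<le> \<bar>k u\<bar>"
      by (intro always_eventually allI AE_I2) (simp add: abs_mult mult_left_le_one_le)
    show "integrable lborel (\<lambda>u. \<bar>k u\<bar>)" using k by (rule integrable_abs)
  qed measurable
  then show "((\<lambda>t. kernel_cdf k (- t)) \<longlongrightarrow> 0) at_top"
    by (simp add: kernel_cdf_altdef)
qed

text \<open>The hypothesis \<open>z \<noteq> 0\<close> excludes the point where the left-hand side stays at \<open>1 -
  kernel_cdf k 0\<close>.\<close>

lemma smoothed_sign_limit:
  assumes k: "integrable lborel k" and k1: "(\<integral>u. k u \<partial>lborel) = 1"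
    and h: "filterlim h (at_right 0) sequentially" and z: "z \<noteq> 0"
  shows "(\<lambda>n. 1 - kernel_cdf k (- (z / (2 * h n)))) \<longlonglongrightarrow> indicator {0<..} z"
proof (cases "z > 0")
  case True
  have "filterlim (\<lambda>n. - (z / 2 * inverse (h n))) at_bot sequentially"
    using filterlim_tendsto_pos_mult_at_top[OF tendsto_const _ filterlim_compose[OF filterlim_inverse_at_top_right h], of "z / 2"] True
    by (simp add: filterlim_uminus_at_top)
  then have "filterlim (\<lambda>n. - (z / (2 * h n))) at_bot sequentially"
    by (simp add: inverse_eq_divide)
  from tendsto_diff[OF tendsto_const filterlim_compose[OF kernel_cdf_at_bot[OF k] this], of 1]
  show ?thesis using True by simp
next
  case False
  have "filterlim (\<lambda>n. (- z / 2) * inverse (h n)) at_top sequentially"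
    using filterlim_tendsto_pos_mult_at_top[OF tendsto_const _ filterlim_compose[OF filterlim_inverse_at_top_right h], of "- z / 2"] False z
    by simp
  then have "filterlim (\<lambda>n. - (z / (2 * h n))) at_top sequentially"
    by (simp add: inverse_eq_divide)
  from tendsto_diff[OF tendsto_const filterlim_compose[OF kernel_cdf_at_top[OF k] this], of 1]
  show ?thesis using False by (simp add: k1)
qed

section \<open>Distribution functions of continuous and of symmetric laws\<close>

lemma (in prob_space) AE_obtain_in:
  assumes "AE x in M. Q x" and [measurable]: "A \<in> sets M" and "measure M A > 0"
  obtains x where "x \<in> A" "Q x"
proof -
  have "\<exists>x. x \<in> A \<and> Q x"
  proof (rule ccontr)
    assume "\<nexists>x. x \<in> A \<and> Q x"
    then have "AE x in M. x \<notin> A"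
      by (intro eventually_mono[OF assms(1)]) auto
    then have "measure M A = 0"
      using AE_iff_null_sets[OF assms(2)] by (simp add: null_sets_def measure_def)
    with assms(3) show False by simp
  qed
  then show ?thesis using that by blast
qed

lemma (in real_distribution) cdf_attains:
  assumes cont: "\<And>x. isCont (cdf M) x" and c: "0 < c" "c < 1"
  obtains z where "cdf M z = c"
proof -
  obtain a where a: "cdf M a < c"
    using order_tendstoD(2)[OF cdf_lim_at_bot c(1)] by (auto simp: eventually_at_bot_linorder)
  obtain b where b: "cdf M b > c"
    using order_tendstoD(1)[OF cdf_lim_at_top_prob c(2)] by (auto simp: eventually_at_top_linorder)
  have "a \<le> b"
    using a b cdf_nondecreasing[of b a] by linarith
  then obtain z where "cdf M z = c"
    using IVT[of "cdf M" a c b] a b cont by auto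
  then show ?thesis by (rule that)
qed

text \<open>With positive probability \<open>cdf M x\<close> is at least \<open>(c + 1) / 2\<close>, and with positive
  probability it is at most \<open>c / 2\<close>. A shift by \<open>s \<ge> 0\<close> can only increase the values, which
  contradicts the first fact; a shift to the left contradicts the second.\<close>

lemma (in real_distribution) cdf_shift_not_AE_constant:
  assumes cont: "\<And>x. isCont (cdf M) x" and c: "0 < c" "c < 1"
  shows "\<not> (AE x in M. cdf M (x + s) = c)"
proof
  assume AE: "AE x in M. cdf M (x + s) = c"
  show False
  proof (cases "s \<ge> 0")
    case True
    obtain z where z: "cdf M z = (c + 1) / 2"
      using cdf_attains[OF cont, of "(c + 1) / 2"] c by auto
    have "measure M {z<..} = 1 - cdf M z"
      using prob_compl[of "{..z}"] by (simp add: cdf_def Compl_eq_Diff_UNIV[symmetric])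
    then have "measure M {z<..} > 0" using z c by simp
    then obtain x where "x \<in> {z<..}" "cdf M (x + s) = c"
      using AE_obtain_in[OF AE, of "{z<..}"] by auto
    then show False using cdf_nondecreasing[of z "x + s"] True z c by simp
  next
    case False
    obtain z where z: "cdf M z = c / 2"
      using cdf_attains[OF cont, of "c / 2"] c by auto
    have "measure M {..z} > 0" using z c by (simp add: cdf_def)
    then obtain x where "x \<in> {..z}" "cdf M (x + s) = c"
      using AE_obtain_in[OF AE, of "{..z}"] by auto
    then show False using cdf_nondecreasing[of "x + s" z] False z c by simp
  qed
qed

lemma real_distribution_density:
  fixes f :: "real \<Rightarrow> real"
  assumes f_nonneg: "\<And>x. 0 \<le> f x" and f: "has_bochner_integral lborel f 1"
  shows "real_distribution (density lborel f)"
    and "cdf (density lborel f) x = (LBINT t:{..x}. f t)"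
    and "isCont (cdf (density lborel f)) x"
proof -
  let ?D = "density lborel f"
  have int: "integrable lborel f" and f1: "integral\<^sup>L lborel f = 1"
    using f by (auto simp: has_bochner_integral_iff)
  have f_meas[measurable]: "f \<in> borel_measurable borel"
    using borel_measurable_integrable[OF int] by simp
  have "emeasure ?D (space ?D) = (\<integral>\<^sup>+x. ennreal (f x) \<partial>lborel)"
    by (simp add: emeasure_density)
  also have "\<dots> = 1"
    using int f_nonneg by (simp add: nn_integral_eq_integral f1)
  finally have "prob_space ?D" by (rule prob_spaceI)
  then interpret D: real_distribution ?D
    by (simp add: real_distribution_def real_distribution_axioms_def)
  show "real_distribution ?D" ..
  have "emeasure ?D {..x} = (\<integral>\<^sup>+t. ennreal (indicator {..x} t * f t) \<partial>lborel)" for x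
    by (subst emeasure_density) (auto intro!: nn_integral_cong simp: indicator_def)
  also have "\<dots> x = ennreal (LBINT t:{..x}. f t)" for x
    unfolding set_lebesgue_integral_def real_scaleR_def
    by (intro nn_integral_eq_integral integrable_lborel_indicator_mult int) (auto simp: f_nonneg)
  finally have "emeasure ?D {..x} = ennreal (LBINT t:{..x}. f t)" for x .
  then show "cdf ?D x = (LBINT t:{..x}. f t)"
    using f_nonneg by (simp add: cdf_def measure_def set_lebesgue_integral_def)
  have "emeasure ?D {x} = 0"
    using AE_lborel_singleton[of x] by (subst emeasure_density) (auto simp: nn_integral_0_iff_AE)
  then show "isCont (cdf ?D) x"
    by (simp add: D.isCont_cdf measure_def)
qed

lemma symmetric_density_cdf_minus:
  fixes f :: "real \<Rightarrow> real"
  assumes f: "has_bochner_integral lborel f 1" and sym: "\<And>x. f (- x) = f x"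
  shows "(LBINT t:{..- x}. f t) = 1 - (LBINT t:{..x}. f t)"
proof -
  have int: "integrable lborel f" and f1: "integral\<^sup>L lborel f = 1"
    using f by (auto simp: has_bochner_integral_iff)
  have f_meas[measurable]: "f \<in> borel_measurable borel"
    using borel_measurable_integrable[OF int] by simp
  have ints: "integrable lborel (\<lambda>t. indicator {..x} t * f t)" "integrable lborel (\<lambda>t. indicator {x..} t * f t)"
    by (intro integrable_lborel_indicator_mult int; simp)+
  have "(LBINT t:{..- x}. f t) = (\<integral>t. indicator {x..} t * f t \<partial>lborel)"
    unfolding set_lebesgue_integral_def
    by (subst lborel_integral_real_affine[where c = "- 1" and t = 0])
       (auto simp: sym indicator_def intro!: Bochner_Integration.integral_cong)
  moreover have "(LBINT t:{..x}. f t) + (\<integral>t. indicator {x..} t * f t \<partial>lborel)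
      = (\<integral>t. indicator {..x} t * f t + indicator {x..} t * f t \<partial>lborel)"
    using ints by (simp add: set_lebesgue_integral_def)
  moreover have "\<dots> = integral\<^sup>L lborel f"
    using AE_lborel_singleton[of x]
    by (intro integral_cong_AE) (auto simp: indicator_def elim!: eventually_mono)
  ultimately show ?thesis using f1 by linarith
qed

section \<open>The smoothed Wilcoxon signed rank statistic\<close>

lemma (in prob_space) indep_vars_shift:
  assumes "indep_vars (\<lambda>_. N) X {1..}"
  shows "indep_vars (\<lambda>_. N) (\<lambda>i. X (Suc i)) UNIV"
proof -
  have "indep_vars (\<lambda>i. PiM {Suc i} (\<lambda>_. N)) (\<lambda>i \<omega>. restrict (\<lambda>j. X j \<omega>) {Suc i}) UNIV"
    by (rule indep_vars_restrict[OF assms]) (auto simp: disjoint_family_on_def)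
  then have "indep_vars (\<lambda>_. N) (\<lambda>i \<omega>. (\<lambda>f. f (Suc i)) (restrict (\<lambda>j. X j \<omega>) {Suc i})) UNIV"
    by (rule indep_vars_compose2) simp
  then show ?thesis by simp
qed

lemma smoothed_wilcoxon_eq:
  "smoothed_wilcoxon k h n x
    = (\<Sum>j<n. \<Sum>i\<le>j. 1 - kernel_cdf k (- ((x (Suc i) + x (Suc j)) / (2 * h))))"
proof -
  have "(\<Sum>j<n. \<Sum>i\<le>j. 1) = real n * (real n + 1) / 2"
    by (induction n) (auto simp: field_simps)
  then show ?thesis
    unfolding smoothed_wilcoxon_def sum.atLeast1_atMost_eq lessThan_Suc_atMost One_nat_def
    by (simp only: sum_subtractf)
qed

theorem theorem5:
  fixes M :: "'a measure"
    and X :: "nat \<Rightarrow> 'a \<Rightarrow> real"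
    and F f k :: "real \<Rightarrow> real"
    and \<theta> c d :: real
    and h :: "nat \<Rightarrow> real"
    and W :: "nat \<Rightarrow> 'a \<Rightarrow> real"
  assumes "prob_space M"
    and "prob_space.indep_vars M (\<lambda>_. borel) X {1..}"
    and "\<And>i x. i \<ge> 1 \<Longrightarrow> cdf (distr M borel (X i)) x = F (x - \<theta>)"
    and "\<And>x. f x \<ge> 0"
    and "has_bochner_integral lborel f 1"
    and "\<And>x. F x = (LBINT t:{..x}. f t)"
    and "\<And>x. f (- x) = f x"
    and "0 < F (- \<theta>)" and "F (- \<theta>) < 1"
    and "deriv_continuous_near f (- \<theta>)"
    and "has_bochner_integral lborel k 1"
    and "\<And>u. k (- u) = k u"
    and "c > 0" and "1 / 4 < d" and "d < 1 / 2"
    and "\<And>n. n \<ge> 1 \<Longrightarrow> h n = c * real n powr (- d)"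
  defines "W \<equiv> \<lambda>n \<omega>. smoothed_wilcoxon k (h n) n (\<lambda>i. X i \<omega>)"
  shows "weak_conv_m
           (\<lambda>n. distr M borel
             (\<lambda>\<omega>. (W n \<omega> - prob_space.expectation M (W n))
                    / sqrt (prob_space.variance M (W n))))
           std_normal_distribution"
proof -
  note indep = assms(2) and cdf_X = assms(3) and f_nonneg = assms(4) and f = assms(5)
    and F = assms(6) and f_sym = assms(7) and F_pos = assms(8) and F_less = assms(9)
    and k = assms(11) and c = assms(13) and d = assms(14) and h_eq = assms(16)
  interpret prob_space M by fact
  define P where "P = distr M borel (X 1)"
  have X[measurable]: "X i \<in> borel_measurable M" if "i \<ge> 1" for i
    using indep that by (auto simp: indep_vars_def2)
  interpret P: real_distribution P
    unfolding P_def by (rule real_distribution_distr) simp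
  have distr_X: "distr M borel (X i) = P" if "i \<ge> 1" for i
    unfolding P_def using that cdf_X by (intro cdf_unique real_distribution_distr ext) auto
  have indep': "indep_vars (\<lambda>_. P) (\<lambda>i. X (Suc i)) UNIV"
    using indep_vars_shift[OF indep] by (simp add: indep_vars_def2 cong: measurable_cong_sets)
  interpret iid_sequence M P "\<lambda>i. X (Suc i)"
  proof
    show "distr M P (X (Suc i)) = P" for i
      using distr_X[of "Suc i"] by (simp cong: distr_cong)
  qed (rule indep')

  have cdf_P: "cdf P x = F (x - \<theta>)" for x
    unfolding P_def using cdf_X by simp
  have F_minus: "F (- x) = 1 - F x" for x
    unfolding F by (rule symmetric_density_cdf_minus[OF f f_sym])
  have F_cdf: "F = cdf (density lborel f)"
    using real_distribution_density(2)[OF f_nonneg f] F by auto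
  have "isCont F x" for x
    unfolding F_cdf by (rule real_distribution_density(3)[OF f_nonneg f])
  then have "isCont (\<lambda>x. F (x - \<theta>)) x" for x
    by (rule isCont_o2[where f = "\<lambda>x. x - \<theta>", rotated]) simp
  then have cont: "isCont (cdf P) x" for x
    by (simp add: cdf_P[abs_def])
  have k_int: "integrable lborel k" and k1: "(\<integral>u. k u \<partial>lborel) = 1"
    using k by (auto simp: has_bochner_integral_iff)
  have k_meas: "k \<in> borel_measurable borel"
    using borel_measurable_integrable[OF k_int] by simp
  note [measurable] = borel_measurable_kernel_cdf[OF k_meas]

  have h: "filterlim h (at_right 0) sequentially"
  proof -
    have "(\<lambda>n. c * real n powr (- d)) \<longlonglongrightarrow> c * 0"
      using d by (intro tendsto_intros tendsto_neg_powr filterlim_real_sequentially) auto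
    then have "h \<longlonglongrightarrow> 0"
      using tendsto_cong[OF eventually_sequentiallyI[of 1 "\<lambda>n. h n = c * real n powr (- d)"]] h_eq
      by simp
    moreover have "\<forall>\<^sub>F n in sequentially. h n > 0"
      using c by (intro eventually_sequentiallyI[of 1]) (simp add: h_eq)
    ultimately show ?thesis
      by (auto simp: filterlim_at elim: eventually_mono)
  qed

  define \<phi> where "\<phi> n x y = 1 - kernel_cdf k (- ((x + y) / (2 * h n)))" for n x y
  have \<phi>_le: "\<bar>\<phi> n x y\<bar> \<le> 1 + (\<integral>u. \<bar>k u\<bar> \<partial>lborel)" for n x y
    using abs_kernel_cdf_le[OF k_int, of "- ((x + y) / (2 * h n))"] by (auto simp: \<phi>_def)
  have W: "W n = (\<lambda>\<omega>. \<Sum>j<n. \<Sum>i\<le>j. \<phi> n (X (Suc i) \<omega>) (X (Suc j) \<omega>))" for n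
    unfolding W_def \<phi>_def by (rule ext) (rule smoothed_wilcoxon_eq)

  \<comment> \<open>The limit kernel has its only discontinuity in \<open>y\<close> at \<open>- x\<close>, which has probability 0.\<close>
  have projection: "(\<lambda>n. \<integral>y. \<phi> n x y \<partial>P) \<longlonglongrightarrow> cdf P (x + 2 * \<theta>)" for x
  proof -
    have "measure P {- x} = 0"
      using cont P.isCont_cdf by simp
    then have "AE y in P. y \<noteq> - x"
      using AE_iff_null_sets[of "{- x}" P] by (auto simp: null_sets_def P.emeasure_eq_measure)
    then have "AE y in P. (\<lambda>n. \<phi> n x y) \<longlonglongrightarrow> indicator {0<..} (x + y)"
      unfolding \<phi>_def by eventually_elim (intro smoothed_sign_limit k_int k1 h, auto)
    then have "(\<lambda>n. \<integral>y. \<phi> n x y \<partial>P) \<longlonglongrightarrow> (\<integral>y. indicator {0<..} (x + y) \<partial>P)"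
      by (intro integral_dominated_convergence[where w = "\<lambda>_. 1 + (\<integral>u. \<bar>k u\<bar> \<partial>lborel)"])
         (use \<phi>_le in \<open>auto simp: \<phi>_def\<close>)
    also have "(\<integral>y. indicator {0<..} (x + y) \<partial>P) = (\<integral>y. indicator {- x<..} y \<partial>P)"
      by (intro Bochner_Integration.integral_cong) (auto simp: indicator_def)
    also have "\<dots> = measure P {- x<..}" by simp
    also have "\<dots> = 1 - cdf P (- x)"
      using P.prob_compl[of "{..- x}"] by (simp add: cdf_def Compl_eq_Diff_UNIV[symmetric])
    also have "\<dots> = cdf P (x + 2 * \<theta>)"
    proof -
      have "- x - \<theta> = - (x + \<theta>)" "x + 2 * \<theta> - \<theta> = x + \<theta>" by simp_all
      then show ?thesis by (simp only: cdf_P F_minus)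
    qed
    finally show ?thesis .
  qed

  have nonconst: "\<not> (AE x in P. cdf P (x + 2 * \<theta>) = a)" for a
  proof
    assume AE: "AE x in P. cdf P (x + 2 * \<theta>) = a"
    \<comment> \<open>A positive and a nonpositive observation each occur with positive probability; comparing \<open>a\<close> with \<open>F \<theta>\<close> there gives \<open>a = F \<theta> = 1 - F (- \<theta>)\<close>.\<close>
    have P0: "measure P {..0} = F (- \<theta>)"
      using cdf_P[of 0] by (simp add: cdf_def)
    have "measure P {0<..} = 1 - F (- \<theta>)"
      using P.prob_compl[of "{..0}"] P0 by (simp add: Compl_eq_Diff_UNIV[symmetric])
    then obtain x where "x \<in> {0<..}" "cdf P (x + 2 * \<theta>) = a"
      using P.AE_obtain_in[OF AE, of "{0<..}"] F_less by auto
    then have "F \<theta> \<le> a"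
      using P.cdf_nondecreasing[of "2 * \<theta>" "x + 2 * \<theta>"] by (simp add: cdf_P[of "2 * \<theta>"])
    moreover obtain y where "y \<in> {..0}" "cdf P (y + 2 * \<theta>) = a"
      using P.AE_obtain_in[OF AE, of "{..0}"] F_pos P0 by auto
    then have "a \<le> F \<theta>"
      using P.cdf_nondecreasing[of "y + 2 * \<theta>" "2 * \<theta>"] by (simp add: cdf_P[of "2 * \<theta>"])
    ultimately have "0 < a" "a < 1"
      using F_minus[of \<theta>] F_pos F_less by auto
    then show False
      using P.cdf_shift_not_AE_constant[OF cont] AE by blast
  qed

  show ?thesis
    unfolding W
  proof (rule triangular_U_statistic_asymptotically_normal[OF _ _ \<phi>_le projection nonconst])
    show "(\<lambda>(x, y). \<phi> n x y) \<in> borel_measurable (P \<Otimes>\<^sub>M P)" for n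
      unfolding \<phi>_def by measurable
    show "\<phi> n x y = \<phi> n y x" for n x y
      by (simp add: \<phi>_def add.commute)
  qed
qed

end
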